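(* Let $k\geq 1$ be an integer and let $u,v$ be two factors of the Cantor sequence $\mathbf{c}$ with $|u|=|v|$. If $\mathrm{pref}_{k}(u)=\mathrm{pref}_{k}(v)$ and $\mathrm{suff}_{k}(u)=\mathrm{suff}_{k}(v)$, then $u\sim_{k+1}v$ if and only if $u\sim_{1}v$.
   Context: The Cantor sequence $\mathbf{c}=c_0c_1c_2\cdots\in\{0,1\}^{\mathbb N}$ is defined by $c_0=1$ and $c_{3n}=c_{3n+2}=c_n$, $c_{3n+1}=0$ for all $n\geq 0$ (so $\mathbf c=101000101000000000101000101\cdots$). A factor of $\mathbf c$ is a finite word of the form $c_ic_{i+1}\cdots c_{i+m-1}$. For a word $u=u_0\cdots u_{n-1}$ and $\ell\geq1$, $\mathrm{pref}_\ell(u)=u_0\cdots u_{\ell-1}$ and $\mathrm{suff}_\ell(u)=u_{n-\ell}\cdots u_{n-1}$; for $\ell\le 0$ both are the empty word. $|u|$ is the length of $u$ and $|u|_w$ the number of occurrences of the word $w$ as a factor of $u$. For an integer $k\geq1$, two words $u,v$ are $k$-abelian equivalent, written $u\sim_k v$, if $\mathrm{pref}_{k-1}(u)=\mathrm{pref}_{k-1}(v)$, $\mathrm{suff}_{k-1}(u)=\mathrm{suff}_{k-1}(v)$ and $|u|_w=|v|_w$ for every word $w$ of length $k$ over the alphabet. (Thus $u\sim_1 v$ means $u,v$ contain each letter the same number of times.) *)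

theory Defs
  imports Main
begin

fun cantor :: "nat \<Rightarrow> nat" where
  "cantor n = (if n = 0 then 1 else if n mod 3 = 1 then 0 else cantor (n div 3))"

declare cantor.simps [simp del]

lemma cantor_rec:
  "cantor 0 = 1"
  "cantor (3 * n) = cantor n"
  "cantor (3 * n + 1) = 0"
  "cantor (3 * n + 2) = cantor n"
proof -
  show "cantor 0 = 1" by (simp add: cantor.simps)
  show "cantor (3 * n) = cantor n"
    by (cases "n = 0") (simp_all add: cantor.simps [of "3 * n"])
  have "(3 * n + 1) mod 3 = 1" by presburger
  then show "cantor (3 * n + 1) = 0" by (subst cantor.simps) simp
  have "(3 * n + 2) mod 3 = 2" "(3 * n + 2) div 3 = n" by presburger+
  then show "cantor (3 * n + 2) = cantor n" by (subst cantor.simps) simp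
qed

definition is_factor :: "(nat \<Rightarrow> 'a) \<Rightarrow> 'a list \<Rightarrow> bool" where
  "is_factor s u \<longleftrightarrow> (\<exists>i m. u = map s [i..<i + m])"

text \<open>For \<open>l > length u\<close> the prefix and the suffix of length \<open>l\<close> are the whole word \<open>u\<close>.\<close>

definition pref :: "nat \<Rightarrow> 'a list \<Rightarrow> 'a list" where
  "pref l u = take l u"

definition suff :: "nat \<Rightarrow> 'a list \<Rightarrow> 'a list" where
  "suff l u = drop (length u - l) u"

text \<open>Occurrences are counted by starting position, so overlapping ones are counted separately.\<close>

definition occ :: "'a list \<Rightarrow> 'a list \<Rightarrow> nat" where
  "occ u w = card {i. i + length w \<le> length u \<and> take (length w) (drop i u) = w}"

text \<open>\<open>A\<close> is the alphabet; the relation is meant for \<open>k \<ge> 1\<close>.\<close>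

definition kab_equiv :: "'a set \<Rightarrow> nat \<Rightarrow> 'a list \<Rightarrow> 'a list \<Rightarrow> bool" where
  "kab_equiv A k u v \<longleftrightarrow>
     pref (k - 1) u = pref (k - 1) v \<and>
     suff (k - 1) u = suff (k - 1) v \<and>
     (\<forall>w \<in> lists A. length w = k \<longrightarrow> occ u w = occ v w)"

end

theory Submission
  imports Defs
begin

text \<open>
  Equality of the counts is lifted from words of length \<open>l + 1\<close> to words of length \<open>l + 2\<close>.
  For a word \<open>z\<close> of length \<open>l\<close>, the prefix and suffix conditions make all row and column sums
  of the \<open>2 \<times> 2\<close> matrix of the counts of \<open>a z b\<close> the same for \<open>u\<close> and \<open>v\<close>, so it suffices that
  one entry agrees. If \<open>z\<close> contains a \<open>1\<close>, one of \<open>1z1\<close>, \<open>0z1\<close>, \<open>1z0\<close> is not a factor of the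
  Cantor sequence at all, and if \<open>z\<close> consists of \<open>l\<close> zeros, \<open>1z1\<close> is a factor only if \<open>l\<close> is a
  power \<open>3^t\<close>. In that last case division of positions by \<open>3^t\<close> reduces the matter to counting
  \<open>101\<close> against \<open>100\<close> in a window. These alternate, so the counts could differ only by the way the
  window cuts the blocks \<open>101\<close> at its two ends; a discrepancy would contradict, modulo 3, the
  equality of the lengths.
\<close>

section \<open>Occurrences and one-letter extensions\<close>

lemma occ_nth:
  "occ u w = card {x. x + length w \<le> length u \<and> (\<forall>y<length w. u ! (x + y) = w ! y)}"
proof -
  have "(take (length w) (drop x u) = w) = (\<forall>y<length w. u ! (x + y) = w ! y)"
    if "x + length w \<le> length u" for x
    using that by (auto simp: list_eq_iff_nth_eq)
  then show ?thesis unfolding occ_def by (metis (no_types, lifting))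
qed

lemma suff_eq_iff:
  assumes "length w \<le> length u"
  shows "suff (length w) u = w \<longleftrightarrow> (\<forall>y<length w. u ! (length u - length w + y) = w ! y)"
  using assms unfolding suff_def by (auto simp: list_eq_iff_nth_eq)

lemma pref_eq_iff:
  assumes "length w \<le> length u"
  shows "pref (length w) u = w \<longleftrightarrow> (\<forall>y<length w. u ! y = w ! y)"
  using assms unfolding pref_def by (auto simp: list_eq_iff_nth_eq)

text \<open>Every occurrence of \<open>w\<close>, except one at the very end of \<open>u\<close>, is
  followed by a letter, and that letter decides which one-letter extension it belongs to. The last
  summand accounts for the final occurrence.\<close>

lemma occ_snoc_sum:
  assumes "finite A" "set u \<subseteq> A" "length w \<le> length u"
  shows "occ u w = (\<Sum>a\<in>A. occ u (w @ [a])) + (if suff (length w) u = w then 1 else 0)"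
proof -
  let ?l = "length w" and ?n = "length u"
  define S where "S a = {x. x + Suc ?l \<le> ?n \<and> (\<forall>y<?l. u ! (x + y) = w ! y) \<and> u ! (x + ?l) = a}" for a
  define R where "R = {x. x = ?n - ?l \<and> (\<forall>y<?l. u ! (x + y) = w ! y)}"
  have fin: "finite (S a)" for a
    by (rule finite_subset[of _ "{..?n}"]) (auto simp: S_def)
  have S: "occ u (w @ [a]) = card (S a)" for a
    unfolding occ_nth S_def by (rule arg_cong[where f = card]) (auto simp: nth_append less_Suc_eq)
  have "{x. x + ?l \<le> ?n \<and> (\<forall>y<?l. u ! (x + y) = w ! y)} = (\<Union>a\<in>A. S a) \<union> R"
  proof -
    have "u ! (x + ?l) \<in> A" "Suc (x + ?l) \<le> ?n" if "x + ?l \<le> ?n" "x \<noteq> ?n - ?l" for x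
      using that assms(2) by (auto intro: nth_mem)
    then show ?thesis using assms(3) by (auto simp: S_def R_def)
  qed
  then have "occ u w = card ((\<Union>a\<in>A. S a) \<union> R)"
    by (simp add: occ_nth)
  also have "\<dots> = card (\<Union>a\<in>A. S a) + card R"
  proof (rule card_Un_disjoint)
    show "finite (\<Union>a\<in>A. S a)" using assms(1) fin by blast
  qed (use assms(3) in \<open>auto simp: S_def R_def\<close>)
  also have "card (\<Union>a\<in>A. S a) = (\<Sum>a\<in>A. card (S a))"
    using assms(1) fin by (intro card_UN_disjoint) (auto simp: S_def)
  also have "card R = (if suff ?l u = w then 1 else 0)"
    unfolding suff_eq_iff[OF assms(3)] R_def by (auto simp: card_1_singleton_iff)
  finally show ?thesis by (simp add: S)
qed

lemma occ_Cons_sum: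
  assumes "finite A" "set u \<subseteq> A" "length w \<le> length u"
  shows "occ u w = (\<Sum>a\<in>A. occ u (a # w)) + (if pref (length w) u = w then 1 else 0)"
proof -
  let ?l = "length w" and ?n = "length u"
  define S where "S a = {x. x + Suc ?l \<le> ?n \<and> (\<forall>y<?l. u ! (Suc x + y) = w ! y) \<and> u ! x = a}" for a
  define R where "R = {x. x = 0 \<and> (\<forall>y<?l. u ! (x + y) = w ! y)}"
  have fin: "finite (S a)" for a
    by (rule finite_subset[of _ "{..?n}"]) (auto simp: S_def)
  have S: "occ u (a # w) = card (S a)" for a
    unfolding occ_nth S_def
    by (rule arg_cong[where f = card]) (auto simp: nth_Cons less_Suc_eq_0_disj)
  \<comment> \<open>An occurrence of \<open>a # w\<close> at \<open>x\<close> is an occurrence of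
    \<open>w\<close> at \<open>Suc x\<close>; only an occurrence at 0 has no letter before
    it.\<close>
  have "{x. x + ?l \<le> ?n \<and> (\<forall>y<?l. u ! (x + y) = w ! y)} = Suc ` (\<Union>a\<in>A. S a) \<union> R" (is "?X = ?Y")
  proof (intro set_eqI)
    fix x show "x \<in> ?X \<longleftrightarrow> x \<in> ?Y"
    proof (cases x)
      case 0
      then show ?thesis using assms by (auto simp: R_def)
    next
      case (Suc x')
      have "x' < ?n \<Longrightarrow> u ! x' \<in> A" using assms(2) by auto
      then show ?thesis using Suc by (auto simp: R_def S_def)
    qed
  qed
  then have "occ u w = card (Suc ` (\<Union>a\<in>A. S a) \<union> R)"
    by (simp add: occ_nth)
  also have "\<dots> = card (Suc ` (\<Union>a\<in>A. S a)) + card R"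
    using assms by (intro card_Un_disjoint) (auto simp: fin R_def)
  also have "card (Suc ` (\<Union>a\<in>A. S a)) = (\<Sum>a\<in>A. card (S a))"
    using assms(1) fin by (subst card_image, simp, intro card_UN_disjoint) (auto simp: S_def)
  also have "card R = (if pref ?l u = w then 1 else 0)"
    unfolding pref_eq_iff[OF assms(3)] R_def by (auto simp: card_1_singleton_iff)
  finally show ?thesis by (simp add: S)
qed

section \<open>Blocks and gaps of the Cantor sequence\<close>

lemma cantor_01: "cantor n = 0 \<or> cantor n = 1"
proof (induction n rule: cantor.induct)
  case (1 n)
  then show ?case by (subst (1 2) cantor.simps) auto
qed

lemma mod_3_cases:
  obtains m where "n = 3 * m" | m where "n = 3 * m + 1" | m where "n = 3 * m + (2::nat)"
proof -
  have "n mod 3 = 0 \<or> n mod 3 = 1 \<or> n mod 3 = 2" by presburger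
  moreover have "n = 3 * (n div 3) + n mod 3" by simp
  ultimately show ?thesis using that by (metis add.right_neutral)
qed

text \<open>Two adjacent ones could only straddle the boundary of two blocks \<open>3 * m\<close>,
  \<open>3 * m + 1\<close>, \<open>3 * m + 2\<close>, and there they would copy adjacent ones at
  \<open>m\<close> and \<open>m + 1\<close>.\<close>

lemma cantor_no_11: "cantor n = 1 \<Longrightarrow> cantor (n + 1) = 0"
proof (induction n rule: less_induct)
  case (less n)
  show ?case
  proof (cases n rule: mod_3_cases)
    case (1 m) then show ?thesis using cantor_rec(3)[of m] by simp
  next
    case (2 m) then show ?thesis using less.prems cantor_rec(3)[of m] by simp
  next
    case (3 m)
    then have "cantor m = 1" using less.prems cantor_rec(4)[of m] by simp
    then have "cantor (m + 1) = 0" using less.IH[of m] 3 by simp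
    moreover have "n + 1 = 3 * (m + 1)" using 3 by simp
    ultimately show ?thesis by (simp only: cantor_rec)
  qed
qed

lemma cantor_1_mod_3:
  assumes "cantor n = 1"
  obtains m where "n = 3 * m" "cantor m = 1" | m where "n = 3 * m + 2" "cantor m = 1"
  using assms cantor_rec(2-4) by (cases n rule: mod_3_cases) auto

text \<open>A one is the first or the last letter of a block \<open>101\<close>. If it is the last,
  the whole next block is zero, because its source letter follows a one.\<close>

lemma cantor_1_mod_3_follow:
  assumes "cantor n = 1"
  shows "n mod 3 = 0 \<Longrightarrow> cantor (n + 2) = 1"
    and "n mod 3 \<noteq> 0 \<Longrightarrow> n mod 3 = 2 \<and> 2 \<le> n \<and> cantor (n - 2) = 1 \<and> cantor (n + 2) = 0 \<and> cantor (n + 3) = 0"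
proof -
  show "n mod 3 = 0 \<Longrightarrow> cantor (n + 2) = 1"
    using assms
  proof (cases n rule: cantor_1_mod_3)
    case (1 m)
    then show ?thesis using cantor_rec(4)[of m] by simp
  next
    case (2 m)
    moreover assume "n mod 3 = 0"
    ultimately show ?thesis by presburger
  qed
  assume "n mod 3 \<noteq> 0"
  then obtain m where m: "n = 3 * m + 2" "cantor m = 1"
    using cantor_1_mod_3[OF assms] by (metis mod_mult_self1_is_0)
  have "n + 2 = 3 * (m + 1) + 1" "n + 3 = 3 * (m + 1) + 2" "n - 2 = 3 * m" using m by auto
  then show "n mod 3 = 2 \<and> 2 \<le> n \<and> cantor (n - 2) = 1 \<and> cantor (n + 2) = 0 \<and> cantor (n + 3) = 0"
    using m cantor_no_11[of m] by (simp only: cantor_rec) presburger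
qed

lemma cantor_1_mod_3_ne_1: "cantor n = 1 \<Longrightarrow> n mod 3 \<noteq> 1"
  using cantor_1_mod_3_follow(2)[of n] by (metis one_eq_numeral_iff semiring_norm(85) zero_neq_one)

text \<open>Here \<open>n\<close> begins a block, so \<open>n - 2\<close> is the middle letter of
  the block before.\<close>

lemma cantor_1_mod_3_precede:
  assumes "cantor n = 1" "n mod 3 = 0" "n \<ge> 2"
  shows "cantor (n - 2) = 0"
proof -
  obtain m where m: "n = 3 * (m + 1)" "cantor (m + 1) = 1"
  proof (cases rule: cantor_1_mod_3[OF assms(1)])
    case (1 m)
    then show ?thesis using that[of "m - 1"] assms(3) by auto
  next
    case (2 m)
    then show ?thesis using assms(2) by presburger
  qed
  have "n - 2 = 3 * m + 1" using m by auto
  then show ?thesis by (simp only: cantor_rec)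
qed

section \<open>Powers of 3, runs of zeros, and synchronization\<close>

lemma cantor_pow3: "cantor (3 ^ t * q) = cantor q"
proof (induction t)
  case (Suc t)
  have "cantor (3 ^ Suc t * q) = cantor (3 * (3 ^ t * q))" by (simp add: mult.assoc)
  then show ?case using Suc cantor_rec by simp
qed simp

text \<open>In base 3 the position is \<open>q\<close> followed by \<open>t\<close> digits 2, and
  appending a digit 2 copies the letter.\<close>

lemma cantor_pow3_last: "cantor (3 ^ t * q + 3 ^ t - 1) = cantor q"
proof (induction t)
  case (Suc t)
  have "(1::nat) \<le> 3 ^ t" by simp
  then have "3 ^ Suc t * q + 3 ^ Suc t - 1 = 3 * (3 ^ t * q + 3 ^ t - 1) + 2"
    unfolding power_Suc mult.assoc by linarith
  then show ?case using Suc cantor_rec by simp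
qed simp

text \<open>A one with at least three zeros behind it ends its block and has only zero blocks in
  that range, so dividing positions by 3 lowers \<open>t\<close> by one. For \<open>t = 0\<close>
  the zero comes for free, as no two ones are adjacent.\<close>

lemma cantor_1_zeros_iff:
  "cantor p = 1 \<and> (\<forall>y. 1 \<le> y \<and> y \<le> 3 ^ t \<longrightarrow> cantor (p + y) = 0)
    \<longleftrightarrow> (\<exists>q. p = 3 ^ t * q + 3 ^ t - 1 \<and> cantor q = 1)"
proof (induction t arbitrary: p)
  case 0
  have "(1 \<le> y \<and> y \<le> 1) = (y = 1)" for y :: nat by auto
  then show ?case using cantor_no_11[of p] by auto
next
  case (Suc t)
  define L :: nat where "L = 3 ^ t"
  have L: "L \<ge> 1" by (simp add: L_def)
  show ?case
  proof (cases p rule: mod_3_cases)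
    case (1 m)
    have "\<not> (cantor p = 1 \<and> (\<forall>y. 1 \<le> y \<and> y \<le> 3 ^ Suc t \<longrightarrow> cantor (p + y) = 0))"
    proof
      assume a: "cantor p = 1 \<and> (\<forall>y. 1 \<le> y \<and> y \<le> 3 ^ Suc t \<longrightarrow> cantor (p + y) = 0)"
      then have "cantor (p + 2) = 0" using L unfolding power_Suc L_def[symmetric] by (simp del: add_2_eq_Suc')
      with a 1 show False using cantor_1_mod_3_follow(1)[of p] by simp
    qed
    moreover have "p \<noteq> 3 ^ Suc t * q + 3 ^ Suc t - 1" for q
      using 1 L unfolding power_Suc L_def[symmetric] by (simp add: mult.assoc) presburger
    ultimately show ?thesis by blast
  next
    case (2 m)
    have "cantor p = 0" using 2 cantor_rec by simp
    moreover have "p \<noteq> 3 ^ Suc t * q + 3 ^ Suc t - 1" for q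
      using 2 L unfolding power_Suc L_def[symmetric] by (simp add: mult.assoc) presburger
    ultimately show ?thesis by (metis zero_neq_one)
  next
    case (3 m)
    \<comment> \<open>The \<open>3 * L\<close> letters after \<open>p\<close> are exactly the blocks
      of \<open>m + 1\<close> to \<open>m + L\<close>; the offset \<open>3 * y - 2\<close> leads to
      the first letter of the block of \<open>m + y\<close>.\<close>
    have "(\<forall>y. 1 \<le> y \<and> y \<le> 3 * L \<longrightarrow> cantor (p + y) = 0) \<longleftrightarrow>
          (\<forall>y. 1 \<le> y \<and> y \<le> L \<longrightarrow> cantor (m + y) = 0)" (is "?P \<longleftrightarrow> ?Q")
    proof
      assume P: ?P
      show ?Q
      proof (intro allI impI)
        fix y assume y: "1 \<le> y \<and> y \<le> L"
        then have e: "p + (3 * y - 2) = 3 * (m + y)" using 3 by auto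
        have "1 \<le> 3 * y - 2 \<and> 3 * y - 2 \<le> 3 * L" using y by auto
        then have "cantor (p + (3 * y - 2)) = 0" using P by blast
        then show "cantor (m + y) = 0" unfolding e by (simp only: cantor_rec)
      qed
    next
      assume Q: ?Q
      show ?P
      proof (intro allI impI)
        fix y assume y: "1 \<le> y \<and> y \<le> 3 * L"
        \<comment> \<open>The position \<open>p + y\<close> lies in the block of
          \<open>m + z\<close>.\<close>
        define z where "z = (y + 2) div 3"
        have z: "1 \<le> z \<and> z \<le> L" using y by (auto simp: z_def)
        then have c: "cantor (m + z) = 0" using Q by blast
        have "p + y = 3 * (m + z) \<or> p + y = 3 * (m + z) + 1 \<or> p + y = 3 * (m + z) + 2"
          using 3 y unfolding z_def by presburger
        then show "cantor (p + y) = 0" using c cantor_rec by metis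
      qed
    qed
    moreover have "cantor p = cantor m" using 3 cantor_rec by simp
    moreover have "p = 3 ^ Suc t * q + 3 ^ Suc t - 1 \<longleftrightarrow> m = 3 ^ t * q + 3 ^ t - 1" for q
      using 3 L unfolding power_Suc L_def[symmetric] by (simp add: mult.assoc) presburger
    ultimately show ?thesis using Suc[of m] by (simp add: L_def)
  qed
qed

text \<open>A gap inside a block \<open>101\<close> has length 1. Any other gap runs from the end of
  one such block to the beginning of another, so it is three times as long as the gap between their
  source letters.\<close>

lemma cantor_gap_pow3:
  assumes "cantor p = 1" "cantor (p + L + 1) = 1" "\<forall>y. 1 \<le> y \<and> y \<le> L \<longrightarrow> cantor (p + y) = 0"
  shows "\<exists>t. L = 3 ^ t"
  using assms
proof (induction L arbitrary: p rule: less_induct)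
  case (less L)
  have L: "L \<noteq> 0" using less.prems cantor_no_11[of p] by (intro notI) simp
  show ?case
  proof (cases rule: cantor_1_mod_3[OF less.prems(1)])
    case (1 m)
    then have "cantor (p + 2) = 1" using cantor_1_mod_3_follow(1)[OF less.prems(1)] by simp
    then have "\<not> 2 \<le> L" using less.prems(3) by (auto simp del: add_2_eq_Suc')
    then have "L = 3 ^ 0" using L by simp
    then show ?thesis by blast
  next
    case p: (2 m)
    show ?thesis
    proof (cases rule: cantor_1_mod_3[OF less.prems(2)])
      case e: (1 m')
      define L' where "L' = m' - m - 1"
      have L': "L = 3 * L'" "m' = m + L' + 1" using p e L unfolding L'_def by presburger+
      have "cantor (m + y) = 0" if "1 \<le> y" "y \<le> L'" for y
      proof -
        have "1 \<le> 3 * y - 2 \<and> 3 * y - 2 \<le> L" using that L' by auto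
        then have "cantor (p + (3 * y - 2)) = 0" using less.prems(3) by blast
        moreover have "p + (3 * y - 2) = 3 * (m + y)" using p that by auto
        ultimately show ?thesis by (simp only: cantor_rec)
      qed
      then obtain t where "L' = 3 ^ t" using less.IH[of L' m] L L' p e by auto
      then have "L = 3 ^ Suc t" using L' by simp
      then show ?thesis by blast
    next
      case e: (2 m')
      \<comment> \<open>If the second one ended its block, the first letter of that block would be a
        one inside the gap.\<close>
      have "L \<ge> 2" using p e L by presburger
      then have "1 \<le> L - 1 \<and> L - 1 \<le> L" by auto
      then have "cantor (p + (L - 1)) = 0" using less.prems(3) by blast
      moreover have "p + (L - 1) = 3 * m'" using e L by auto
      ultimately show ?thesis using e cantor_rec by simp
    qed
  qed
qed

text \<open>A one at \<open>p\<close> begins its block if \<open>cantor (p + 2) = 1\<close> and ends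
  it if \<open>cantor (p - 2) = 1\<close>, and otherwise these letters are zero. So either neighbour
  alone reveals the residue.\<close>

lemma cantor_1_residue_eq:
  assumes "cantor p = 1" "cantor q = 1"
    and "cantor (p + 2) = cantor (q + 2) \<or> 2 \<le> p \<and> 2 \<le> q \<and> cantor (p - 2) = cantor (q - 2)"
  shows "p mod 3 = q mod 3"
proof -
  have False if "cantor p = 1" "cantor q = 1" "p mod 3 = 0" "q mod 3 \<noteq> 0"
    "cantor (p + 2) = cantor (q + 2) \<or> 2 \<le> p \<and> 2 \<le> q \<and> cantor (p - 2) = cantor (q - 2)" for p q
    using that cantor_1_mod_3_follow(1)[of p] cantor_1_mod_3_follow(2)[of q] cantor_1_mod_3_precede[of p]
    by (metis zero_neq_one)
  then show ?thesis
    using assms cantor_1_mod_3_follow(2)[of p] cantor_1_mod_3_follow(2)[of q] by metis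
qed

text \<open>Infinite descent: the ones on the two sides of the common word must end and begin a
  block, and the one inside it fixes the residue modulo 3 of all three occurrences. The word thus
  consists of whole blocks, and their source is a shorter word with the same properties.\<close>

lemma cantor_no_strong_bispecial:
  assumes "cantor p = 1" "cantor (p + L + 1) = 1"
    and "cantor q = 0" "cantor (q + L + 1) = 1"
    and "cantor r = 1" "cantor (r + L + 1) = 0"
    and "\<And>y. 1 \<le> y \<Longrightarrow> y \<le> L \<Longrightarrow> cantor (p + y) = cantor (q + y)"
    and "\<And>y. 1 \<le> y \<Longrightarrow> y \<le> L \<Longrightarrow> cantor (p + y) = cantor (r + y)"
    and "1 \<le> x" "x \<le> L" "cantor (p + x) = 1"
  shows False
  using assms
proof (induction L arbitrary: p q r x rule: less_induct)
  case (less L)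
  note prems = less.prems
  have x2: "x \<noteq> 1" using cantor_no_11[OF prems(1)] prems(11) by (intro notI) simp
  \<comment> \<open>If \<open>p\<close> began a block, \<open>p + 2\<close> would end it and
    \<open>p + 4\<close> would be zero. The copy \<open>q + 2\<close> cannot end a block, since
    \<open>cantor q = 0\<close>; so it begins one and \<open>q + 4\<close> carries a one, a
    contradiction.\<close>
  have p3: "p mod 3 \<noteq> 0"
  proof
    assume 0: "p mod 3 = 0"
    then have p2: "cantor (p + 2) = 1" using cantor_1_mod_3_follow(1)[OF prems(1)] by simp
    have "(p + 2) mod 3 \<noteq> 0" using 0 by presburger
    then have "cantor (p + 2 + 2) = 0 \<and> cantor (p + 2 + 3) = 0"
      using cantor_1_mod_3_follow(2)[OF p2] by blast
    then have p4: "cantor (p + 4) = 0" "cantor (p + 5) = 0" by (simp_all add: eval_nat_numeral)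
    have "cantor (p + 3) = 0" using cantor_no_11[OF p2] by (simp add: eval_nat_numeral)
    with p4 have "L \<noteq> 2" "L \<noteq> 3" "L \<noteq> 4" using prems(2) by (auto simp: eval_nat_numeral)
    with x2 prems(9,10) have L: "5 \<le> L" by linarith
    have q2: "cantor (q + 2) = 1" using p2 prems(7)[of 2] L by simp
    have q4: "cantor (q + 4) = 0" using p4 prems(7)[of 4] L by simp
    have "(q + 2) mod 3 = 0"
      using cantor_1_mod_3_follow(2)[OF q2] prems(3) by auto
    then have "cantor (q + 2 + 2) = 1" by (rule cantor_1_mod_3_follow(1)[OF q2])
    then show False using q4 by (simp add: eval_nat_numeral)
  qed
  note p_facts = cantor_1_mod_3_follow(2)[OF prems(1) p3]
  have "x \<noteq> 2" "x \<noteq> 3" using p_facts prems(11) by auto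
  then have L: "4 \<le> L" using x2 prems(9,10) by linarith
  define e where "e = p + L + 1"
  \<comment> \<open>The mirror argument with \<open>r\<close> in place of \<open>q\<close>: if
    \<open>e\<close> ended a block, \<open>e - 2\<close> would begin it and \<open>e - 4\<close>
    would be zero, while the copy of \<open>e - 2\<close> at \<open>r\<close> must end a block.
    Below, \<open>K = L - 3\<close>, so that \<open>e - 4\<close> is \<open>p + K\<close>.\<close>
  have e3: "e mod 3 = 0"
  proof (rule ccontr)
    assume "e mod 3 \<noteq> 0"
    then have e: "e mod 3 = 2" "cantor (e - 2) = 1"
      using cantor_1_mod_3_follow(2)[of e] prems(2) by (auto simp: e_def)
    obtain K where K: "L = K + 3" "1 \<le> K"
      using L that[of "L - 3"] by simp
    have eK: "e - 2 = p + (K + 2)" "p + (K + 2) - 2 = p + K" "r + (K + 2) - 2 = r + K"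
      using K by (simp_all add: e_def)
    have "(e - 2) mod 3 = 0" using e(1) K unfolding e_def by presburger
    then have "cantor (p + K) = 0"
      using cantor_1_mod_3_precede[OF e(2)] unfolding eK by simp
    then have rK: "cantor (r + K) = 0" using prems(8)[of K] K by simp
    have r2: "cantor (r + (K + 2)) = 1"
      using e(2) prems(8)[of "K + 2"] K unfolding eK by simp
    have "r + (K + 2) + 2 = r + L + 1" using K by simp
    then have "(r + (K + 2)) mod 3 \<noteq> 0"
      using cantor_1_mod_3_follow(1)[OF r2] prems(6) by (metis zero_neq_one)
    then have "cantor (r + (K + 2) - 2) = 1" using cantor_1_mod_3_follow(2)[OF r2] by blast
    then show False using rK unfolding eK by simp
  qed
  \<comment> \<open>The neighbour of \<open>p + x\<close> that decides its residue lies inside the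
    common word: on the right because \<open>e\<close> begins a block, on the left because
    \<open>x \<ge> 3\<close>.\<close>
  have same: "s mod 3 = 2" if "\<And>y. 1 \<le> y \<Longrightarrow> y \<le> L \<Longrightarrow> cantor (p + y) = cantor (s + y)" for s
  proof -
    have sx: "cantor (s + x) = 1" using that prems(9-11) by simp
    have "cantor (p + x + 2) = cantor (s + x + 2) \<or>
      2 \<le> p + x \<and> 2 \<le> s + x \<and> cantor (p + x - 2) = cantor (s + x - 2)"
    proof (cases "(p + x) mod 3 = 0")
      case True
      then have "x + 2 \<le> L" using e3 prems(10) unfolding e_def by presburger
      then show ?thesis using that[of "x + 2"] by (simp add: add.assoc)
    next
      case False
      have "x \<ge> 3" using \<open>x \<noteq> 1\<close> \<open>x \<noteq> 2\<close> prems(9) by linarith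
      then show ?thesis using that[of "x - 2"] prems(10) by simp
    qed
    then have "(p + x) mod 3 = (s + x) mod 3"
      using cantor_1_residue_eq[OF prems(11) sx] by blast
    then show ?thesis using p_facts by presburger
  qed
  have "q mod 3 = 2" "r mod 3 = 2" using same prems(7,8) by blast+
  then obtain m mq mr where m: "p = 3 * m + 2" "q = 3 * mq + 2" "r = 3 * mr + 2"
    using p_facts by (metis mult_div_mod_eq)
  have "p mod 3 = 2" using p_facts by blast
  with e3 have "3 dvd L" unfolding e_def by presburger
  then obtain L' where L': "L = 3 * L'" by blast
  \<comment> \<open>The one at \<open>p + x\<close> lies in the block of \<open>m + x'\<close>, so
    the shorter word contains a one as well.\<close>
  define x' where "x' = (x + 2) div 3"
  have x': "1 \<le> x'" "x' \<le> L'" using prems(9,10) L' unfolding x'_def by presburger+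
  have shift: "1 \<le> y \<Longrightarrow> cantor (3 * n + 2 + (3 * y - 2)) = cantor (n + y)"
    "cantor (3 * n + 2 + 3 * y + 1) = cantor (n + y + 1)" for n y
  proof -
    assume "1 \<le> y"
    then have "3 * n + 2 + (3 * y - 2) = 3 * (n + y)" by simp
    then show "cantor (3 * n + 2 + (3 * y - 2)) = cantor (n + y)" by (simp only: cantor_rec)
  next
    have "3 * n + 2 + 3 * y + 1 = 3 * (n + y + 1)" by simp
    then show "cantor (3 * n + 2 + 3 * y + 1) = cantor (n + y + 1)" by (simp only: cantor_rec)
  qed
  have win: "cantor (m + y) = cantor (n + y)"
    if "\<And>y. 1 \<le> y \<Longrightarrow> y \<le> L \<Longrightarrow> cantor (p + y) = cantor (3 * n + 2 + y)" "1 \<le> y" "y \<le> L'" for n y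
  proof -
    have "1 \<le> 3 * y - 2" "3 * y - 2 \<le> L" using that(2,3) L' by auto
    from that(1)[OF this] show ?thesis unfolding m(1) shift(1)[OF that(2)] .
  qed
  show False
  proof (rule less.IH[of L' m mq mr x'])
    show "L' < L" using L L' by linarith
    show "cantor m = 1" "cantor mq = 0" "cantor mr = 1"
      using prems(1,3,5) m cantor_rec by simp_all
    show "cantor (m + L' + 1) = 1" "cantor (mq + L' + 1) = 1" "cantor (mr + L' + 1) = 0"
      using prems(2,4,6) by (simp_all only: m L' shift(2))
    show "cantor (m + y) = cantor (mq + y)" "cantor (m + y) = cantor (mr + y)"
      if "1 \<le> y" "y \<le> L'" for y
      using win that prems(7,8) m by blast+
    have "p + x = 3 * (m + x') \<or> p + x = 3 * (m + x') + 1 \<or> p + x = 3 * (m + x') + 2"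
      using m prems(9) unfolding x'_def by presburger
    then show "cantor (m + x') = 1" using prems(11) cantor_rec by (metis zero_neq_one)
  qed (use x' in auto)
qed

text \<open>For positive \<open>t\<close> the window has at least four letters, so it contains a
  neighbour at distance two of its one, which fixes the residue modulo 3. Passing to the source
  letters leaves a window for \<open>t - 1\<close>.\<close>

lemma cantor_window_aligned:
  assumes "\<And>y. y \<le> 3 ^ t \<Longrightarrow> cantor (i + y) = cantor (j + y)"
    and "z \<le> 3 ^ t" "cantor (i + z) = 1"
  shows "i mod 3 ^ t = j mod 3 ^ t"
  using assms
proof (induction t arbitrary: i j z)
  case (Suc t)
  define T :: nat where "T = 3 ^ t"
  have T: "T \<ge> 1" by (simp add: T_def)
  have eq: "cantor (i + y) = cantor (j + y)" if "y \<le> 3 * T" for y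
    using Suc.prems(1)[of y] that by (simp add: T_def)
  have z: "z \<le> 3 * T" using Suc.prems(2) by (simp add: T_def)
  have "(i + z) mod 3 = (j + z) mod 3"
  proof (rule cantor_1_residue_eq)
    show "cantor (i + z) = 1" "cantor (j + z) = 1"
      using Suc.prems(3) eq[OF z] by simp_all
    show "cantor (i + z + 2) = cantor (j + z + 2) \<or>
      2 \<le> i + z \<and> 2 \<le> j + z \<and> cantor (i + z - 2) = cantor (j + z - 2)"
    proof (cases "z \<ge> 2")
      case True
      then show ?thesis using eq[of "z - 2"] z by simp
    next
      case False
      then show ?thesis using eq[of "z + 2"] T by (simp add: add.assoc)
    qed
  qed
  then have mod: "i mod 3 = j mod 3" by (auto simp: nat_mod_eq_iff)
  define a b s where "a = i div 3" and "b = j div 3" and "s = i mod 3"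
  have ij: "i = 3 * a + s" "j = 3 * b + s" "s < 3"
    using mod unfolding a_def b_def s_def by presburger+
  \<comment> \<open>Each source letter is read off the first or the last letter of its block. Both
    are needed: for \<open>y = 0\<close> and \<open>s > 0\<close> the first lies before the window,
    for \<open>y = T\<close> and \<open>s < 2\<close> the last lies behind it.\<close>
  have "cantor (a + y) = cantor (b + y)" if "y \<le> T" for y
  proof (cases "s = 2 \<or> s = 1 \<and> y = 0")
    case True
    then have "cantor (i + (3 * y + (2 - s))) = cantor (j + (3 * y + (2 - s)))"
      using that T by (intro eq) auto
    moreover have "i + (3 * y + (2 - s)) = 3 * (a + y) + 2" "j + (3 * y + (2 - s)) = 3 * (b + y) + 2"
      using ij True by auto
    ultimately show ?thesis by (simp only: cantor_rec)
  next
    case False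
    have s: "s \<le> 3 * y" using False ij by auto
    have "cantor (i + (3 * y - s)) = cantor (j + (3 * y - s))"
      using that by (intro eq) auto
    moreover have "i + (3 * y - s) = 3 * (a + y)" "j + (3 * y - s) = 3 * (b + y)"
      using ij s by auto
    ultimately show ?thesis by (simp only: cantor_rec)
  qed
  moreover obtain y where "y \<le> T" "cantor (a + y) = 1"
  proof -
    define y where "y = (z + s) div 3"
    have "i + z = 3 * (a + y) \<or> i + z = 3 * (a + y) + 1 \<or> i + z = 3 * (a + y) + 2"
      using ij unfolding y_def by presburger
    then have "cantor (a + y) = 1" using Suc.prems(3) cantor_rec by (metis zero_neq_one)
    moreover have "y \<le> T"
      using z ij(3) less_mult_imp_div_less[of "z + s" "Suc T" 3] by (simp add: y_def)
    ultimately show ?thesis using that by blast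
  qed
  ultimately have "a mod T = b mod T" using Suc.IH[of a b y] by (simp add: T_def)
  then have "(3 * a + s) mod (3 * T) = (3 * b + s) mod (3 * T)"
    by (metis mod_add_left_eq mult_mod_right)
  then show ?case by (simp add: ij T_def)
qed simp

section \<open>Counting the gaps of length \<open>3^t\<close>\<close>

lemma occ_factor:
  "occ (map s [i..<i + n]) w = card {x. x + length w \<le> n \<and> (\<forall>y<length w. s (i + x + y) = w ! y)}"
  unfolding occ_nth by (rule arg_cong[where f = card]) (auto simp: add.assoc)

lemma occ_factor_pos:
  assumes "is_factor s u" "occ u w \<noteq> 0"
  shows "\<exists>p. \<forall>y<length w. s (p + y) = w ! y"
proof -
  obtain i n where u: "u = map s [i..<i + n]" using assms(1) unfolding is_factor_def by blast
  have "{x. x + length w \<le> n \<and> (\<forall>y<length w. s (i + x + y) = w ! y)} \<noteq> {}"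
    using assms(2) unfolding u occ_factor by (metis card.empty)
  then show ?thesis by auto
qed

text \<open>The positions with quotient \<open>q\<close> by \<open>T\<close> form a block whose
  first and last letters both copy \<open>cantor q\<close>. The first two equations read two source
  letters to the right of a left end \<open>i\<close>, the other two to the left of a right end,
  always within distance \<open>T\<close>.\<close>

lemma cantor_div_pow3:
  fixes i t
  defines "T \<equiv> 3 ^ t"
  shows "cantor (i div T) = cantor (i + (T - 1 - i mod T))"
    and "cantor (i div T + 1) = cantor (i + (T - i mod T))"
    and "cantor (i div T) = cantor (i - i mod T)"
    and "T \<le> i \<Longrightarrow> cantor (i div T - 1) = cantor (i - i mod T - 1)"
proof -
  have T: "T \<ge> 1" by (simp add: T_def)
  have m: "i mod T < T" using T by simp
  have i: "i = T * (i div T) + i mod T" by simp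
  have "i + (T - 1 - i mod T) = T * (i div T) + T - 1" using i m by linarith
  then show "cantor (i div T) = cantor (i + (T - 1 - i mod T))"
    using cantor_pow3_last[of t "i div T"] by (simp add: T_def)
  have "i + (T - i mod T) = T * (i div T) + T" using i m by linarith
  then have "i + (T - i mod T) = T * (i div T + 1)" by simp
  then show "cantor (i div T + 1) = cantor (i + (T - i mod T))"
    using cantor_pow3[of t "i div T + 1"] by (simp add: T_def)
  have e: "i - i mod T = T * (i div T)" using i by linarith
  then show "cantor (i div T) = cantor (i - i mod T)"
    using cantor_pow3[of t "i div T"] by (simp add: T_def)
  assume "T \<le> i"
  then have "1 \<le> i div T" using T by (simp add: div_greater_zero_iff Suc_leI)
  then obtain d where d: "i div T = d + 1" by (metis add.commute le_Suc_ex)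
  have "i - i mod T - 1 = T * d + T - 1" unfolding e d by simp
  then show "cantor (i div T - 1) = cantor (i - i mod T - 1)"
    using cantor_pow3_last[of t d] d by (simp add: T_def)
qed

text \<open>By \<open>cantor_1_zeros_iff\<close> an occurrence starts at the last letter of the
  \<open>T\<close>-block of some \<open>q\<close> with \<open>cantor q = 1\<close>; it covers the
  zero block of \<open>q + 1\<close> and ends at the first letter of the block of
  \<open>q + 2\<close>.\<close>

lemma occ_one_zeros:
  fixes i n t a
  defines "T \<equiv> 3 ^ t"
  assumes "n \<ge> 1"
  shows "occ (map cantor [i..<i + n]) (1 # replicate T 0 @ [a]) =
    card {q. i div T \<le> q \<and> q + 2 \<le> (i + n - 1) div T \<and> cantor q = 1 \<and> cantor (q + 2) = a}"
proof -
  let ?w = "1 # replicate T 0 @ [a]"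
  let ?X = "{x. x + length ?w \<le> n \<and> (\<forall>y<length ?w. cantor (i + x + y) = ?w ! y)}"
  let ?Q = "{q. i div T \<le> q \<and> q + 2 \<le> (i + n - 1) div T \<and> cantor q = 1 \<and> cantor (q + 2) = a}"
  have T: "T \<ge> 1" by (simp add: T_def)
  have w: "(\<forall>y<length ?w. f y = ?w ! y) \<longleftrightarrow>
      f 0 = 1 \<and> (\<forall>y. 1 \<le> y \<and> y \<le> T \<longrightarrow> f y = 0) \<and> f (T + 1) = a" (is "?L \<longleftrightarrow> ?R") for f :: "nat \<Rightarrow> nat"
  proof
    assume L: ?L
    have "f y = 0" if "1 \<le> y" "y \<le> T" for y
      using L that by (auto simp: nth_Cons nth_append split: nat.splits dest!: spec[of _ y])
    moreover have "f 0 = 1" using L by auto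
    moreover have "f (T + 1) = a" using L by (auto simp: nth_append dest!: spec[of _ "T + 1"])
    ultimately show ?R by blast
  next
    assume R: ?R
    show ?L
    proof (intro allI impI)
      fix y assume "y < length ?w"
      then have "y = 0 \<or> 1 \<le> y \<and> y \<le> T \<or> y = T + 1" by auto
      then show "f y = ?w ! y" using R by (auto simp: nth_Cons nth_append split: nat.splits)
    qed
  qed
  have mat: "(\<forall>y<length ?w. cantor (i + x + y) = ?w ! y) \<longleftrightarrow>
      (\<exists>q. i + x = T * q + T - 1 \<and> cantor q = 1 \<and> cantor (q + 2) = a)" for x
  proof -
    have last: "cantor (T * q + T - 1 + (T + 1)) = cantor (q + 2)" for q
    proof -
      have "T * q + T - 1 + (T + 1) = T * (q + 2)" using T by simp
      then show ?thesis unfolding T_def by (simp only: cantor_pow3)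
    qed
    have "(\<forall>y<length ?w. cantor (i + x + y) = ?w ! y) \<longleftrightarrow>
        (\<exists>q. i + x = T * q + T - 1 \<and> cantor q = 1) \<and> cantor (i + x + (T + 1)) = a"
      unfolding w cantor_1_zeros_iff[of "i + x" t, folded T_def, symmetric] by simp
    also have "\<dots> \<longleftrightarrow> (\<exists>q. i + x = T * q + T - 1 \<and> cantor q = 1 \<and> cantor (i + x + (T + 1)) = a)"
      by blast
    also have "\<dots> \<longleftrightarrow> (\<exists>q. i + x = T * q + T - 1 \<and> cantor q = 1 \<and> cantor (q + 2) = a)"
      using last by metis
    finally show ?thesis .
  qed
  have lo: "i \<le> T * q + T - 1 \<longleftrightarrow> i div T \<le> q" for q
  proof -
    have "i div T < Suc q \<longleftrightarrow> i < Suc q * T" using T by (simp add: div_less_iff_less_mult)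
    then show ?thesis using T by (auto simp: algebra_simps)
  qed
  \<comment> \<open>The occurrence ends at \<open>T * (q + 2)\<close>, and \<open>n \<ge> 1\<close>
    makes \<open>i + n - 1\<close> the last position of the window.\<close>
  have hi: "T * q + T - 1 + (T + 2) \<le> i + n \<longleftrightarrow> q + 2 \<le> (i + n - 1) div T" for q
  proof -
    have "q + 2 \<le> (i + n - 1) div T \<longleftrightarrow> (q + 2) * T \<le> i + n - 1"
      using T by (simp add: less_eq_div_iff_mult_less_eq)
    moreover have "T * q + T - 1 + (T + 2) = (q + 2) * T + 1" using T by (simp add: algebra_simps)
    moreover have "q' + 1 \<le> i + n \<longleftrightarrow> q' \<le> i + n - 1" for q' using assms(2) by linarith
    ultimately show ?thesis by (simp only:)
  qed
  have "bij_betw (\<lambda>q. T * q + T - 1 - i) ?Q ?X"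
    unfolding bij_betw_def
  proof
    show "inj_on (\<lambda>q. T * q + T - 1 - i) ?Q"
    proof (rule inj_onI)
      fix q q' assume "q \<in> ?Q" "q' \<in> ?Q" and e: "T * q + T - 1 - i = T * q' + T - 1 - i"
      then have "i \<le> T * q + T - 1" "i \<le> T * q' + T - 1" using lo by blast+
      then have "T * q = T * q'" using e T by linarith
      then show "q = q'" using T by simp
    qed
    show "(\<lambda>q. T * q + T - 1 - i) ` ?Q = ?X"
    proof (intro set_eqI iffI)
      fix x assume "x \<in> (\<lambda>q. T * q + T - 1 - i) ` ?Q"
      then obtain q where q: "q \<in> ?Q" "x = T * q + T - 1 - i" by blast
      then have "i \<le> T * q + T - 1" using lo by blast
      then have ix: "i + x = T * q + T - 1" using q(2) by linarith
      have "T * q + T - 1 + (T + 2) \<le> i + n" using hi q(1) by blast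
      then have "x + (T + 2) \<le> n" unfolding ix[symmetric] by linarith
      moreover have "\<forall>y<length ?w. cantor (i + x + y) = ?w ! y" using q(1) ix mat[of x] by blast
      ultimately show "x \<in> ?X" by simp
    next
      fix x assume x: "x \<in> ?X"
      then have "\<forall>y<length ?w. cantor (i + x + y) = ?w ! y" by blast
      then obtain q where q: "i + x = T * q + T - 1" "cantor q = 1" "cantor (q + 2) = a"
        using mat[of x] by blast
      have "x + (T + 2) \<le> n" using x by simp
      then have "T * q + T - 1 + (T + 2) \<le> i + n" unfolding q(1)[symmetric] by linarith
      moreover have "i \<le> T * q + T - 1" unfolding q(1)[symmetric] by simp
      ultimately have "q \<in> ?Q" using q lo[of q] hi[of q] by blast
      moreover have "x = T * q + T - 1 - i" unfolding q(1)[symmetric] by simp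
      ultimately show "x \<in> (\<lambda>q. T * q + T - 1 - i) ` ?Q" by blast
    qed
  qed
  from bij_betw_same_card[OF this] show ?thesis unfolding occ_factor by (rule sym)
qed



text \<open>
  Since \<open>0 \<mapsto> 000\<close>, \<open>1 \<mapsto> 101\<close> fixes the sequence, it splits into blocks \<open>101\<close> and \<open>000\<close> at the
  multiples of 3. A window with first position \<open>A\<close> and last position \<open>E\<close> is cut on the left if it
  begins inside a block \<open>101\<close>. It is cut on the right if its last two letters contain the end of
  a block \<open>101\<close>, so that the \<open>100\<close> starting there does not fit.
\<close>

definition left_cut :: "nat \<Rightarrow> bool" where
  "left_cut A \<longleftrightarrow> A mod 3 = 2 \<and> cantor A = 1 \<or> A mod 3 = 1 \<and> cantor (A + 1) = 1"

definition right_cut :: "nat \<Rightarrow> bool" where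
  "right_cut E \<longleftrightarrow> E mod 3 = 2 \<and> cantor E = 1 \<or> E mod 3 = 0 \<and> cantor (E - 1) = 1"

text \<open>The letter between two positions \<open>q\<close> and \<open>q + 2\<close> with
  \<open>cantor q = 1\<close> is always 0, so this counts \<open>101\<close> for
  \<open>a = 1\<close> and \<open>100\<close> for \<open>a = 0\<close>.\<close>

definition gap_count :: "nat \<Rightarrow> nat \<Rightarrow> nat \<Rightarrow> nat" where
  "gap_count a A E = card {q. A \<le> q \<and> q + 2 \<le> E \<and> cantor q = 1 \<and> cantor (q + 2) = a}"

lemma card_two_nats:
  "card {q. a \<le> q \<and> q \<le> a + 1 \<and> P q} = of_bool (P a) + of_bool (P (a + 1 :: nat))"
proof -
  have "{q. a \<le> q \<and> q \<le> a + 1 \<and> P q} = (if P a then {a} else {}) \<union> (if P (a + 1) then {a + 1} else {})"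
    by (auto simp: le_Suc_eq)
  then show ?thesis by simp
qed

text \<open>Both sides count the ends of blocks \<open>101\<close> in the window. A
  \<open>101\<close> stops at such an end, unless the end is among the first two positions; a
  \<open>100\<close> starts there, unless it is among the last two.\<close>

lemma gap_count_cut:
  assumes "A + 1 \<le> E"
  shows "gap_count 1 A E + of_bool (left_cut A) = gap_count 0 A E + of_bool (right_cut E)"
proof -
  let ?P = "\<lambda>q. q mod 3 = 2 \<and> cantor q = 1"
  let ?F = "{q. A \<le> q \<and> q + 2 \<le> E \<and> cantor q = 1 \<and> cantor (q + 2) = 1}"
  let ?H = "{q. A \<le> q \<and> q + 2 \<le> E \<and> cantor q = 1 \<and> cantor (q + 2) = 0}"
  let ?G = "{q. A \<le> q \<and> q \<le> E \<and> ?P q}"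
  let ?Ls = "{q. A \<le> q \<and> q \<le> A + 1 \<and> ?P q}"
  let ?Rs = "{q. E - 1 \<le> q \<and> q \<le> E - 1 + 1 \<and> ?P q}"
  have F: "cantor q = 1 \<and> cantor (q + 2) = 1 \<longleftrightarrow> ?P (q + 2)" for q
  proof
    assume q: "cantor q = 1 \<and> cantor (q + 2) = 1"
    then have "q mod 3 = 0" using cantor_1_mod_3_follow(2)[of q] by (metis zero_neq_one)
    then have "(q + 2) mod 3 = 2" by presburger
    then show "?P (q + 2)" using q by blast
  next
    assume "?P (q + 2)"
    then show "cantor q = 1 \<and> cantor (q + 2) = 1" using cantor_1_mod_3_follow(2)[of "q + 2"] by simp
  qed
  have H: "cantor q = 1 \<and> cantor (q + 2) = 0 \<longleftrightarrow> ?P q" for q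
    using cantor_1_mod_3_follow[of q] by (metis zero_neq_one zero_neq_numeral)
  have fin: "finite {q. a \<le> q \<and> q \<le> b \<and> R q}" for a b :: nat and R
    by (rule finite_subset[of _ "{..b}"]) auto
  have finHF: "finite {q. A \<le> q \<and> q + 2 \<le> E \<and> R q}" for R
    by (rule finite_subset[of _ "{..E}"]) auto
  have "?G = (\<lambda>q. q + 2) ` ?F \<union> ?Ls"
  proof (intro set_eqI iffI)
    fix q assume q: "q \<in> ?G"
    show "q \<in> (\<lambda>q. q + 2) ` ?F \<union> ?Ls"
    proof (cases "q \<le> A + 1")
      case True then show ?thesis using q by blast
    next
      case False
      then have *: "q = (q - 2) + 2" "A \<le> q - 2" by auto
      moreover have "q - 2 + 2 \<le> E" "?P (q - 2 + 2)" using q *(1) by auto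
      then have "q - 2 \<in> ?F" using F[of "q - 2"] *(2) by blast
      ultimately show ?thesis by blast
    qed
  next
    fix q assume "q \<in> (\<lambda>q. q + 2) ` ?F \<union> ?Ls"
    then show "q \<in> ?G"
    proof
      assume "q \<in> (\<lambda>q. q + 2) ` ?F"
      then obtain q' where q': "q = q' + 2" "A \<le> q'" "q' + 2 \<le> E" "cantor q' = 1 \<and> cantor (q' + 2) = 1"
        by blast
      then show ?thesis using F[of q'] by simp
    next
      assume "q \<in> ?Ls"
      then show ?thesis using assms by simp
    qed
  qed
  then have "card ?G = card ((\<lambda>q. q + 2) ` ?F \<union> ?Ls)" by simp
  also have "\<dots> = card ((\<lambda>q. q + 2) ` ?F) + card ?Ls"
    using fin finHF by (intro card_Un_disjoint) auto
  also have "card ((\<lambda>q. q + 2) ` ?F) = gap_count 1 A E"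
    unfolding gap_count_def by (intro card_image) (auto intro: inj_onI)
  also have "card ?Ls = of_bool (left_cut A)"
  proof -
    \<comment> \<open>At most one of two consecutive positions has residue 2, so the two
      alternatives of \<open>left_cut\<close> exclude each other.\<close>
    have "(A + 1) mod 3 = 2 \<longleftrightarrow> A mod 3 = 1" by presburger
    then show ?thesis unfolding left_cut_def card_two_nats[of A ?P] by (cases "A mod 3 = 2") simp_all
  qed
  finally have G1: "card ?G = gap_count 1 A E + of_bool (left_cut A)" .
  have E: "E - 1 + 1 = E" using assms by simp
  have "A \<le> q \<and> q \<le> E \<longleftrightarrow> A \<le> q \<and> q + 2 \<le> E \<or> E - 1 \<le> q \<and> q \<le> E - 1 + 1" for q
    using assms by linarith
  then have "?G = ?H \<union> ?Rs"
    using H by blast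
  then have "card ?G = card (?H \<union> ?Rs)" by simp
  also have "\<dots> = card ?H + card ?Rs"
    using fin finHF assms by (intro card_Un_disjoint) auto
  also have "card ?Rs = of_bool (right_cut E)"
  proof -
    have "d mod 3 = 2 \<longleftrightarrow> (d + 1) mod 3 = 0" for d :: nat by presburger
    from this[of "E - 1"] have "(E - 1) mod 3 = 2 \<longleftrightarrow> E mod 3 = 0" unfolding E .
    then show ?thesis unfolding right_cut_def card_two_nats[of "E - 1" ?P] unfolding E by (cases "E mod 3 = 2") simp_all
  qed
  finally show ?thesis using G1 by (simp add: gap_count_def)
qed

text \<open>The one that makes \<open>B\<close> cut is shared by \<open>A\<close>. There it can be
  neither in the middle of a block nor at the end, so it begins a block.\<close>

lemma left_cut_residue:
  assumes "cantor A = cantor B" "cantor (A + 1) = cantor (B + 1)" "\<not> left_cut A" "left_cut B"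
  shows "A mod 3 = (B + 1) mod 3"
  using assms(4) unfolding left_cut_def
proof (elim disjE conjE)
  assume B: "B mod 3 = 2" "cantor B = 1"
  then have "A mod 3 \<noteq> 1" "A mod 3 \<noteq> 2"
    using assms(1,3) cantor_1_mod_3_ne_1[of A] unfolding left_cut_def by metis+
  then show ?thesis using B(1) by presburger
next
  assume B: "B mod 3 = 1" "cantor (B + 1) = 1"
  then have "(A + 1) mod 3 \<noteq> 1" "A mod 3 \<noteq> 1"
    using assms(2,3) cantor_1_mod_3_ne_1[of "A + 1"] unfolding left_cut_def by metis+
  then show ?thesis using B(1) by presburger
qed

text \<open>The same on the right: the shared one ends a block for \<open>D\<close> and must begin
  one for \<open>E\<close>. With \<open>E \<ge> 1\<close>, \<open>E - 1\<close> is the true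
  predecessor.\<close>

lemma right_cut_residue:
  assumes "cantor D = cantor E" "cantor (D - 1) = cantor (E - 1)" "right_cut D" "\<not> right_cut E" "E \<ge> 1"
  shows "E mod 3 = (D + 1) mod 3"
  using assms(3) unfolding right_cut_def
proof (elim disjE conjE)
  assume D: "D mod 3 = 2" "cantor D = 1"
  then have "E mod 3 \<noteq> 1" "E mod 3 \<noteq> 2"
    using assms(1,4) cantor_1_mod_3_ne_1[of E] unfolding right_cut_def by metis+
  then show ?thesis using D(1) by presburger
next
  assume D: "D mod 3 = 0" "cantor (D - 1) = 1"
  then have "(E - 1) mod 3 \<noteq> 1" "E mod 3 \<noteq> 0"
    using assms(2,4) cantor_1_mod_3_ne_1[of "E - 1"] unfolding right_cut_def by metis+
  moreover have "e mod 3 \<noteq> 1 \<Longrightarrow> (e + 1) mod 3 \<noteq> 2" for e :: nat by presburger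
  from this[of "E - 1"] have "(E - 1) mod 3 \<noteq> 1 \<Longrightarrow> E mod 3 \<noteq> 2" using assms(5) by simp
  ultimately have "E mod 3 = 1" using mod_3_cases[of E] by force
  moreover have "(D + 1) mod 3 = 1" using D(1) by presburger
  ultimately show ?thesis by simp
qed

text \<open>\<open>E + B = D + A\<close> says that the windows have equal length. The two residue
  shifts do not cancel but add up to 2 modulo 3.\<close>

lemma cut_contradiction:
  assumes "E \<ge> 1" "D \<ge> 1"
    and left: "cantor A = cantor B" "cantor (A + 1) = cantor (B + 1)"
    and right: "cantor E = cantor D" "cantor (E - 1) = cantor (D - 1)"
    and cut: "\<not> left_cut A" "left_cut B" "right_cut E" "\<not> right_cut D"
  shows "E + B \<noteq> D + A"
proof -
  have "A mod 3 = (B + 1) mod 3" "D mod 3 = (E + 1) mod 3"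
    using left_cut_residue[OF left cut(1,2)] right_cut_residue[OF right cut(3,4) assms(2)] .
  then have "(D + A) mod 3 = (E + 1 + (B + 1)) mod 3"
    by (intro mod_add_cong) simp_all
  also have "E + 1 + (B + 1) = E + B + 2" by simp
  finally have "(D + A) mod 3 = (E + B + 2) mod 3" .
  moreover have "(x + 2) mod 3 \<noteq> x mod 3" for x :: nat by presburger
  ultimately show ?thesis by metis
qed

text \<open>With equal sums, different counts force one window to be cut only on the left and the
  other only on the right. Equal lengths exclude this, and so do zeros at the ends, where nothing is
  cut.\<close>

lemma gap_count_eq:
  assumes le: "A + 1 \<le> E" "B + 1 \<le> D"
    and sum: "gap_count 1 A E + gap_count 0 A E = gap_count 1 B D + gap_count 0 B D"
    and left: "cantor A = cantor B" "cantor (A + 1) = cantor (B + 1)"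
    and right: "cantor E = cantor D" "cantor (E - 1) = cantor (D - 1)"
    and len: "E + B = D + A \<or> cantor A = 0 \<and> cantor (A + 1) = 0 \<and> cantor E = 0 \<and> cantor (E - 1) = 0"
  shows "gap_count 1 A E = gap_count 1 B D"
proof (rule ccontr)
  \<comment> \<open>Subtracting the equations expresses \<open>2 * (f - f')\<close> through the four
    cut indicators; being even and nonzero, it is 2 or -2.\<close>
  have balance: "f \<noteq> f' \<Longrightarrow> \<not> l \<and> l' \<and> r \<and> \<not> r' \<or> l \<and> \<not> l' \<and> \<not> r \<and> r'"
    if "f + g = f' + g'" "f + of_bool l = g + of_bool r" "f' + of_bool l' = g' + of_bool r'"
    for f f' g g' :: nat and l l' r r'
    using that by (cases l; cases l'; cases r; cases r'; simp only: of_bool_eq simp_thms; linarith)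
  assume "gap_count 1 A E \<noteq> gap_count 1 B D"
  then have neq: "\<not> left_cut A \<and> left_cut B \<and> right_cut E \<and> \<not> right_cut D \<or>
      left_cut A \<and> \<not> left_cut B \<and> \<not> right_cut E \<and> right_cut D"
    using balance[OF sum gap_count_cut[OF le(1)] gap_count_cut[OF le(2)]] by blast
  then have "\<not> (cantor A = 0 \<and> cantor (A + 1) = 0 \<and> cantor E = 0 \<and> cantor (E - 1) = 0)"
    using left right unfolding left_cut_def by (metis zero_neq_one)
  then have "E + B = D + A" using len by blast
  moreover have "E \<ge> 1" "D \<ge> 1" using le by auto
  ultimately show False
    using neq cut_contradiction[of E D A B] cut_contradiction[of D E B A] left right by metis
qed


section \<open>From windows of blocks back to factors\<close>

lemma set_cantor_factor:
  assumes "is_factor cantor u"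
  shows "set u \<subseteq> {0, 1}"
proof -
  have "set u \<subseteq> range cantor" using assms by (auto simp: is_factor_def)
  also have "\<dots> \<subseteq> {0, 1}" by (rule image_subsetI) (use cantor_01 in simp)
  finally show ?thesis .
qed

text \<open>The common prefix and suffix of length \<open>T + 1\<close> determine the two outer
  letters at each end of the quotient windows. If they contain a one, \<open>i\<close> and
  \<open>j\<close> agree modulo \<open>T\<close> and the quotient windows are equally long;
  otherwise those outer letters are all zero.\<close>

lemma occ_gap_eq:
  fixes i j n t
  defines "T \<equiv> 3 ^ t"
  defines "u \<equiv> map cantor [i..<i + n]" and "v \<equiv> map cantor [j..<j + n]"
  assumes n: "T + 1 \<le> n"
    and pref: "pref (T + 1) u = pref (T + 1) v" and suff: "suff (T + 1) u = suff (T + 1) v"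
    and occ: "occ u (1 # replicate T 0) = occ v (1 # replicate T 0)"
  shows "occ u (1 # replicate T 0 @ [1]) = occ v (1 # replicate T 0 @ [1])"
proof -
  have T: "T \<ge> 1" by (simp add: T_def)
  define e f where "e = i + n - 1" and "f = j + n - 1"
  have len: "length u = n" "length v = n" by (simp_all add: u_def v_def)
  have P: "cantor (i + y) = cantor (j + y)" if "y \<le> T" for y
  proof -
    have "pref (T + 1) u ! y = pref (T + 1) v ! y" using pref by simp
    then show ?thesis using that n by (simp add: pref_def u_def v_def)
  qed
  have S: "cantor (e - y) = cantor (f - y)" if "y \<le> T" for y
  proof -
    have "suff (T + 1) u ! (T - y) = suff (T + 1) v ! (T - y)" using suff by simp
    moreover have "n - (T + 1) + (T - y) = n - 1 - y" "n - 1 - y < n" using that n by simp_all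
    moreover have "i + (n - 1 - y) = e - y" "j + (n - 1 - y) = f - y"
      using that n by (simp_all add: e_def f_def)
    ultimately show ?thesis using len unfolding suff_def
      by (simp add: u_def v_def)
  qed
  define A B D E where "A = i div T" and "B = j div T" and "D = f div T" and "E = e div T"
  have "(i + T) div T \<le> e div T" "(j + T) div T \<le> f div T"
    using n by (auto intro!: div_le_mono simp: e_def f_def)
  moreover have "(x + T) div T = x div T + 1" for x using T by (intro div_add_self2) simp
  ultimately have le: "A + 1 \<le> E" "B + 1 \<le> D" by (simp_all add: A_def B_def D_def E_def)
  have "T \<le> e" "T \<le> f" using n by (auto simp: e_def f_def)
  note blocks_i = cantor_div_pow3(1,2)[of i t, folded T_def, folded A_def]
  note blocks_j = cantor_div_pow3(1,2)[of j t, folded T_def, folded B_def]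
  note blocks_e = cantor_div_pow3(3)[of e t, folded T_def, folded E_def]
    cantor_div_pow3(4)[of t e, folded T_def, folded E_def, OF \<open>T \<le> e\<close>]
  note blocks_f = cantor_div_pow3(3)[of f t, folded T_def, folded D_def]
    cantor_div_pow3(4)[of t f, folded T_def, folded D_def, OF \<open>T \<le> f\<close>]
  have r: "x mod T < T" for x using T by simp
  have rr: "x mod T + 1 \<le> T" for x using r[of x] by simp
  have gc: "occ u (1 # replicate T 0 @ [a]) = gap_count a A E"
    "occ v (1 # replicate T 0 @ [a]) = gap_count a B D" for a
    using occ_one_zeros[of n i t a] occ_one_zeros[of n j t a] n
    unfolding gap_count_def A_def B_def D_def E_def e_def f_def u_def v_def T_def by simp_all
  have sets: "set u \<subseteq> {0, 1}" "set v \<subseteq> {0, 1}"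
    unfolding u_def v_def by (rule set_cantor_factor; unfold is_factor_def; blast)+
  have "length (1 # replicate T (0::nat)) = T + 1" by simp
  then have sum: "gap_count 1 A E + gap_count 0 A E = gap_count 1 B D + gap_count 0 B D"
    using occ_snoc_sum[OF _ sets(1), of "1 # replicate T 0"]
      occ_snoc_sum[OF _ sets(2), of "1 # replicate T 0"] occ suff n len gc
    by simp
  have all0_or: "(\<forall>y\<le>T. cantor (i + y) = 0) \<and> (\<forall>y\<le>T. cantor (e - y) = 0) \<or> i mod T = j mod T"
  proof -
    have "i mod T = j mod T" if "y \<le> T" "cantor (i + y) = 1" for y
      using cantor_window_aligned[of t i j y] P that by (simp add: T_def)
    moreover have "i mod T = j mod T" if "y \<le> T" "cantor (e - y) = 1" for y
    proof -
      \<comment> \<open>The suffix window begins at \<open>e - T\<close>, which has the same offset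
        from \<open>i\<close> as \<open>f - T\<close> has from \<open>j\<close>; so its alignment
        carries over to the left ends.\<close>
      have "(e - T) mod T = (f - T) mod T"
      proof -
        have "cantor (e - T + z) = cantor (f - T + z)" if "z \<le> T" for z
          using S[of "T - z"] that \<open>T \<le> e\<close> \<open>T \<le> f\<close> by simp
        moreover have "cantor (e - T + (T - y)) = 1" using that \<open>T \<le> e\<close> by simp
        ultimately show ?thesis
          using cantor_window_aligned[of t "e - T" "f - T" "T - y"] by (simp add: T_def)
      qed
      moreover have "e - T = i + (n - 1 - T)" "f - T = j + (n - 1 - T)"
        using n by (simp_all add: e_def f_def)
      ultimately show ?thesis by (auto simp: nat_mod_eq_iff)
    qed
    ultimately show ?thesis using cantor_01 by blast
  qed
  have "cantor A = cantor B \<and> cantor (A + 1) = cantor (B + 1) \<and>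
    cantor E = cantor D \<and> cantor (E - 1) = cantor (D - 1) \<and>
    (E + B = D + A \<or> cantor A = 0 \<and> cantor (A + 1) = 0 \<and> cantor E = 0 \<and> cantor (E - 1) = 0)"
    using all0_or
  proof
    assume z: "(\<forall>y\<le>T. cantor (i + y) = 0) \<and> (\<forall>y\<le>T. cantor (e - y) = 0)"
    then have zj: "(\<forall>y\<le>T. cantor (j + y) = 0) \<and> (\<forall>y\<le>T. cantor (f - y) = 0)"
      using P S by simp
    \<comment> \<open>All eight letters are read off within distance \<open>T\<close> of the ends,
      where everything is zero.\<close>
    have le_T: "T - x \<le> T" "y mod T \<le> T" for x y
      using r[of y] by simp_all
    have "T - 1 - x \<le> T" for x by simp
    then show ?thesis
      unfolding blocks_i blocks_j blocks_e blocks_f diff_diff_left[of _ _ 1]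
      using z zj rr le_T by (simp only: simp_thms)
  next
    assume m: "i mod T = j mod T"
    have m': "e mod T = f mod T"
    proof -
      have "e = i + (n - 1)" "f = j + (n - 1)" using n by (simp_all add: e_def f_def)
      then show ?thesis using m by (simp add: nat_mod_eq_iff)
    qed
    have "i = T * A + i mod T" "j = T * B + j mod T" "e = T * E + e mod T" "f = T * D + f mod T"
      by (simp_all add: A_def B_def D_def E_def)
    moreover have "e + j = f + i" using n by (simp add: e_def f_def)
    ultimately have "T * E + T * B = T * D + T * A" using m m' by linarith
    then have "T * (E + B) = T * (D + A)" by (simp add: distrib_left)
    then have "E + B = D + A" using T by simp
    moreover have "cantor A = cantor B" "cantor (A + 1) = cantor (B + 1)"
      unfolding blocks_i blocks_j m by (simp_all add: P)
    moreover have "cantor E = cantor D" "cantor (E - 1) = cantor (D - 1)"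
      unfolding blocks_e blocks_f m' diff_diff_left using S r[of f] by simp_all
    ultimately show ?thesis by blast
  qed
  then have "gap_count 1 A E = gap_count 1 B D"
    using gap_count_eq[OF le sum] by blast
  then show ?thesis unfolding gc .
qed

section \<open>Lifting the counts to longer words\<close>

lemma factor_extension_pos:
  assumes "is_factor s u" "occ u (a # z @ [b]) \<noteq> 0"
  shows "\<exists>p. s p = a \<and> s (p + length z + 1) = b \<and> (\<forall>y. 1 \<le> y \<and> y \<le> length z \<longrightarrow> s (p + y) = z ! (y - 1))"
proof -
  obtain p where p: "\<forall>y<length (a # z @ [b]). s (p + y) = (a # z @ [b]) ! y"
    using occ_factor_pos[OF assms] by blast
  have "s p = a" using p[rule_format, of 0] by simp
  moreover have "s (p + length z + 1) = b"
    using p[rule_format, of "length z + 1"] by (simp add: add.assoc)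
  moreover have "s (p + y) = z ! (y - 1)" if "1 \<le> y \<and> y \<le> length z" for y
  proof -
    have "y - 1 < length z" using that by linarith
    then show ?thesis using p[rule_format, of y] that by (simp add: nth_append)
  qed
  ultimately show ?thesis by blast
qed

text \<open>If all four counts differed, each extension would occur in \<open>u\<close> or
  \<open>v\<close>, hence in the Cantor sequence. This rules out a one in \<open>z\<close>, makes
  the length of \<open>z\<close> a power of 3, and then contradicts
  \<open>occ_gap_eq\<close>.\<close>

lemma occ_extension_eq_somewhere:
  assumes u: "is_factor cantor u" and v: "is_factor cantor v"
    and len: "length u = length v" "length z + 1 \<le> length u"
    and pref: "pref (length z + 1) u = pref (length z + 1) v"
    and suff: "suff (length z + 1) u = suff (length z + 1) v"
    and z: "z \<in> lists {0, 1}"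
    and occ: "\<And>w. w \<in> lists {0, 1} \<Longrightarrow> length w = length z + 1 \<Longrightarrow> occ u w = occ v w"
  shows "\<exists>a\<in>{0, 1}. \<exists>b\<in>{0, 1}. occ u (a # z @ [b]) = occ v (a # z @ [b])"
proof (rule ccontr)
  assume neg: "\<not> ?thesis"
  have ex: "\<exists>p. cantor p = a \<and> cantor (p + length z + 1) = b \<and>
      (\<forall>y. 1 \<le> y \<and> y \<le> length z \<longrightarrow> cantor (p + y) = z ! (y - 1))"
    if "a \<in> {0, 1}" "b \<in> {0, 1}" for a b
  proof -
    have "occ u (a # z @ [b]) \<noteq> occ v (a # z @ [b])" using neg that by blast
    then have "occ u (a # z @ [b]) \<noteq> 0 \<or> occ v (a # z @ [b]) \<noteq> 0" by metis
    then show ?thesis using factor_extension_pos[OF u] factor_extension_pos[OF v] by blast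
  qed
  obtain p where p: "cantor p = 1" "cantor (p + length z + 1) = 1"
    "\<And>y. 1 \<le> y \<Longrightarrow> y \<le> length z \<Longrightarrow> cantor (p + y) = z ! (y - 1)"
    using ex[of 1 1] by auto
  obtain q where q: "cantor q = 0" "cantor (q + length z + 1) = 1"
    "\<And>y. 1 \<le> y \<Longrightarrow> y \<le> length z \<Longrightarrow> cantor (q + y) = z ! (y - 1)"
    using ex[of 0 1] by auto
  obtain r where r: "cantor r = 1" "cantor (r + length z + 1) = 0"
    "\<And>y. 1 \<le> y \<Longrightarrow> y \<le> length z \<Longrightarrow> cantor (r + y) = z ! (y - 1)"
    using ex[of 1 0] by auto
  have no1: "z ! x = 0" if "x < length z" for x
  proof (rule ccontr)
    assume "z ! x \<noteq> 0"
    moreover have "z ! x \<in> {0, 1}" using z that by (metis in_lists_conv_set nth_mem)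
    ultimately have "z ! x = 1" by simp
    then have "cantor (p + Suc x) = 1" using p(3)[of "Suc x"] that by simp
    then show False
      using cantor_no_strong_bispecial[of p "length z" q r "Suc x"] p q r that by simp
  qed
  have "\<forall>y. 1 \<le> y \<and> y \<le> length z \<longrightarrow> cantor (p + y) = 0" using p(3) no1 by simp
  then obtain t where t: "length z = 3 ^ t" using cantor_gap_pow3[OF p(1,2)] by blast
  have zr: "z = replicate (3 ^ t) 0" using no1 t by (simp add: list_eq_iff_nth_eq)
  obtain i n where u': "u = map cantor [i..<i + n]" using u unfolding is_factor_def by blast
  obtain j n' where v': "v = map cantor [j..<j + n']" using v unfolding is_factor_def by blast
  have "n' = n" using len(1) u' v' by simp
  moreover have "occ u (1 # replicate (3 ^ t) 0) = occ v (1 # replicate (3 ^ t) 0)"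
    using occ[of "1 # z"] z zr by simp
  ultimately have "occ u (1 # z @ [1]) = occ v (1 # z @ [1])"
    using occ_gap_eq[of t n i j] len(2) pref suff unfolding t u' v' zr by simp
  then show False using neg by blast
qed

text \<open>The matrix of differences has zero row and column sums, so its entries agree up to sign,
  and one zero entry makes all vanish.\<close>

lemma occ_extension_eq:
  assumes u: "is_factor cantor u" and v: "is_factor cantor v"
    and len: "length u = length v" "length z + 1 \<le> length u"
    and pref: "pref (length z + 1) u = pref (length z + 1) v"
    and suff: "suff (length z + 1) u = suff (length z + 1) v"
    and z: "z \<in> lists {0, 1}"
    and occ: "\<And>w. w \<in> lists {0, 1} \<Longrightarrow> length w = length z + 1 \<Longrightarrow> occ u w = occ v w"
    and ab: "a \<in> {0, 1}" "b \<in> {0, 1}"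
  shows "occ u (a # z @ [b]) = occ v (a # z @ [b])"
proof -
  define X Y where "X a b = occ u (a # z @ [b])" and "Y a b = occ v (a # z @ [b])" for a b
  have row: "X a 0 + X a 1 = Y a 0 + Y a 1" if "a \<in> {0, 1}" for a
  proof -
    have *: "length (a # z) = length z + 1" by simp
    have "occ u (a # z) = occ v (a # z)" using occ[of "a # z"] z that by simp
    then show ?thesis
      using occ_snoc_sum[OF _ set_cantor_factor[OF u], of "a # z"]
        occ_snoc_sum[OF _ set_cantor_factor[OF v], of "a # z"] len suff
      unfolding * X_def Y_def by simp
  qed
  have column: "X 0 b + X 1 b = Y 0 b + Y 1 b" if "b \<in> {0, 1}" for b
  proof -
    have *: "length (z @ [b]) = length z + 1" by simp
    have "occ u (z @ [b]) = occ v (z @ [b])" using occ[of "z @ [b]"] z that by simp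
    then show ?thesis
      using occ_Cons_sum[OF _ set_cantor_factor[OF u], of "z @ [b]"]
        occ_Cons_sum[OF _ set_cantor_factor[OF v], of "z @ [b]"] len pref
      unfolding * X_def Y_def by simp
  qed
  obtain c d where "c \<in> {0, 1}" "d \<in> {0, 1}" "X c d = Y c d"
    using occ_extension_eq_somewhere[OF u v len pref suff z occ] unfolding X_def Y_def by blast
  then have "X a b = Y a b"
    using row[of 0] row[of 1] column[of 0] column[of 1] ab by auto
  then show ?thesis by (simp add: X_def Y_def)
qed

section \<open>Induction on the word length\<close>

lemma pref_mono: "pref k u = pref k v \<Longrightarrow> l \<le> k \<Longrightarrow> pref l u = pref l v"
  unfolding pref_def by (metis min.absorb1 take_take)

lemma suff_conv_pref_rev: "suff l u = rev (pref l (rev u))"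
  by (simp add: suff_def pref_def take_rev)

lemma suff_mono: "suff k u = suff k v \<Longrightarrow> l \<le> k \<Longrightarrow> suff l u = suff l v"
  unfolding suff_conv_pref_rev rev_is_rev_conv by (rule pref_mono)

theorem theorem1p2:
  fixes k :: nat and u v :: "nat list"
  assumes "k \<ge> 1"
    and "is_factor cantor u" and "is_factor cantor v"
    and "length u = length v"
    and "pref k u = pref k v"
    and "suff k u = suff k v"
  shows "kab_equiv {0, 1} (k + 1) u v \<longleftrightarrow> kab_equiv {0, 1} 1 u v"
proof (cases "k \<le> length u")
  case False
  \<comment> \<open>A prefix longer than the word is the whole word.\<close>
  then have "u = v" using assms(4,5) by (simp add: pref_def)
  then show ?thesis by (simp add: kab_equiv_def)
next
  case k: True
  define same where "same l \<longleftrightarrow> (\<forall>w\<in>lists {0, 1}. length w = l \<longrightarrow> occ u w = occ v w)" for l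
  \<comment> \<open>The step to \<open>l + 2\<close> splits a word as \<open>a # z @ [b]\<close>
    with \<open>z\<close> of length \<open>l\<close> and uses prefixes and suffixes of length
    \<open>l + 1 \<le> k\<close>.\<close>
  have up: "same (l + 1)" if "same 1" "l \<le> k" for l
    using that(2)
  proof (induction l)
    case 0 then show ?case using that(1) by simp
  next
    case (Suc l)
    show ?case unfolding same_def
    proof (intro ballI impI)
      fix w :: "nat list" assume w: "w \<in> lists {0, 1}" "length w = Suc l + 1"
      then obtain a w' where w': "w = a # w'" "length w' = Suc l" by (cases w) auto
      then obtain z b where z: "w' = z @ [b]" by (cases w' rule: rev_cases) auto
      have l: "length z + 1 = l + 1" using w' z by simp
      have "occ u (a # z @ [b]) = occ v (a # z @ [b])"
      proof (rule occ_extension_eq[OF assms(2-4)])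
        show "length z + 1 \<le> length u" using l k Suc.prems by simp
        show "pref (length z + 1) u = pref (length z + 1) v"
          using pref_mono[OF assms(5)] l Suc.prems by simp
        show "suff (length z + 1) u = suff (length z + 1) v"
          using suff_mono[OF assms(6)] l Suc.prems by simp
        show "z \<in> lists {0, 1}" "a \<in> {0, 1}" "b \<in> {0, 1}" using w(1) w' z by auto
        show "occ u w = occ v w" if "w \<in> lists {0, 1}" "length w = length z + 1" for w
          using Suc.IH Suc.prems that l unfolding same_def by simp
      qed
      then show "occ u w = occ v w" using w' z by simp
    qed
  qed
  \<comment> \<open>Summing over the last letter recovers the shorter counts, and the common suffix
    settles the final occurrence.\<close>
  have down: "same l" if "same (l + 1)" "l \<le> k" for l
    unfolding same_def
  proof (intro ballI impI)
    fix w :: "nat list" assume w: "w \<in> lists {0, 1}" "length w = l"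
    have "occ u (w @ [a]) = occ v (w @ [a])" if "a \<in> {0, 1}" for a
      using \<open>same (l + 1)\<close> w that unfolding same_def by simp
    moreover have "suff l u = suff l v" using suff_mono[OF assms(6)] that by blast
    ultimately show "occ u w = occ v w"
      using occ_snoc_sum[OF _ set_cantor_factor[OF assms(2)], of w]
        occ_snoc_sum[OF _ set_cantor_factor[OF assms(3)], of w] w(2) k that(2) assms(4)
      by simp
  qed
  have "same 1" if "same (k + 1)"
  proof -
    have "same (Suc 0)" if "same (Suc k)"
      using down that by (intro inc_induct[of 0 k "\<lambda>l. same (Suc l)"]) auto
    then show ?thesis using that by simp
  qed
  moreover have "pref 0 u = pref 0 v" "suff 0 u = suff 0 v" by (simp_all add: pref_def suff_def)
  ultimately show ?thesis
    using up[of k] assms(5,6) unfolding kab_equiv_def same_def by auto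
qed

end
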